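(* As formal power series in $x,y$, $$\Phi(x,y;T,L)=2e^{xy+x+y}-\frac{(xy)^2}{2}-2xy+3-2e^x-2e^y+x(e^y-2y-1)(e^y-1)+y(e^x-2x-1)(e^x-1).$$
   Context: A $(0,1)$-matrix is a matrix with all entries in $\{0,1\}$. A $2\times2$ submatrix of a matrix is obtained by choosing two rows $i_1<i_2$ and two columns $j_1<j_2$. Let $T=\begin{pmatrix}1&1\\0&0\end{pmatrix}$, $L=\begin{pmatrix}1&0\\1&0\end{pmatrix}$, with equivalence classes under row and column exchanges $[T]=\left\{\begin{pmatrix}1&1\\0&0\end{pmatrix},\begin{pmatrix}0&0\\1&1\end{pmatrix}\right\}$ and $[L]=\left\{\begin{pmatrix}1&0\\1&0\end{pmatrix},\begin{pmatrix}0&1\\0&1\end{pmatrix}\right\}$. For $k,n\ge1$, $\phi(k,n;T,L)$ is the number of $k\times n$ $(0,1)$-matrices having no $2\times2$ submatrix in $[T]\cup[L]$. By convention $\phi(0,0;T,L)=1$ and $\phi(k,0;T,L)=\phi(0,n;T,L)=0$ for $k,n\ge1$. The generating function is $\Phi(x,y;T,L)=\sum_{n\ge0}\sum_{k\ge0}\phi(k,n;T,L)\frac{x^k}{k!}\frac{y^n}{n!}$. *)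

theory Defs
  imports
    "HOL-Computational_Algebra.Formal_Power_Series"
    "Jordan_Normal_Form.Column_Operations"
    "Jordan_Normal_Form.DL_Submatrix"
begin

definition mat_T :: "nat mat" where
  "mat_T = mat_of_rows_list 2 [[1, 1], [0, 0]]"

definition mat_L :: "nat mat" where
  "mat_L = mat_of_rows_list 2 [[1, 0], [1, 0]]"

inductive_set exchange_class :: "'a mat \<Rightarrow> 'a mat set" for A :: "'a mat" where
  base: "A \<in> exchange_class A"
| row_exchange: "B \<in> exchange_class A \<Longrightarrow> i < dim_row B \<Longrightarrow> j < dim_row B \<Longrightarrow>
    swaprows i j B \<in> exchange_class A"
| col_exchange: "B \<in> exchange_class A \<Longrightarrow> i < dim_col B \<Longrightarrow> j < dim_col B \<Longrightarrow>
    swapcols i j B \<in> exchange_class A"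

lemma swap_mat2:
  assumes "i < 2" "j < 2"
  shows "swaprows i j (mat_of_rows_list 2 [[a, b], [c, d]]) =
      (if i = j then mat_of_rows_list 2 [[a, b], [c, d]] else mat_of_rows_list 2 [[c, d], [a, b]])"
    and "swapcols i j (mat_of_rows_list 2 [[a, b], [c, d]]) =
      (if i = j then mat_of_rows_list 2 [[a, b], [c, d]] else mat_of_rows_list 2 [[b, a], [d, c]])"
  using assms by (auto simp: mat_of_rows_list_def mat_eq_iff less_2_cases_iff less_Suc_eq)

lemma dim_mat2:
  "dim_row (mat_of_rows_list 2 [[a, b], [c, d]]) = 2"
  "dim_col (mat_of_rows_list 2 [[a, b], [c, d]]) = 2"
  by (simp_all add: mat_of_rows_list_def)

lemma exchange_class_T:
  "exchange_class mat_T = {mat_of_rows_list 2 [[1, 1], [0, 0]], mat_of_rows_list 2 [[0, 0], [1, 1]]}"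
    (is "_ = {?A, ?B}")
proof (intro equalityI subsetI)
  fix M assume "M \<in> exchange_class mat_T"
  then show "M \<in> {?A, ?B}"
    unfolding mat_T_def
  proof induction
    case base
    then show ?case by simp
  next
    case (row_exchange M i j)
    then show ?case by (elim insertE emptyE) (simp_all add: swap_mat2 dim_mat2)
  next
    case (col_exchange M i j)
    then show ?case by (elim insertE emptyE) (simp_all add: swap_mat2 dim_mat2)
  qed
next
  fix M assume M: "M \<in> {?A, ?B}"
  have "swaprows 0 1 ?A \<in> exchange_class ?A"
    by (rule exchange_class.row_exchange[OF exchange_class.base]) (simp_all add: dim_mat2)
  then show "M \<in> exchange_class mat_T"
    using M exchange_class.base[of ?A] by (auto simp: mat_T_def swap_mat2)
qed

lemma exchange_class_L:
  "exchange_class mat_L = {mat_of_rows_list 2 [[1, 0], [1, 0]], mat_of_rows_list 2 [[0, 1], [0, 1]]}"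
    (is "_ = {?A, ?B}")
proof (intro equalityI subsetI)
  fix M assume "M \<in> exchange_class mat_L"
  then show "M \<in> {?A, ?B}"
    unfolding mat_L_def
  proof induction
    case base
    then show ?case by simp
  next
    case (row_exchange M i j)
    then show ?case by (elim insertE emptyE) (simp_all add: swap_mat2 dim_mat2)
  next
    case (col_exchange M i j)
    then show ?case by (elim insertE emptyE) (simp_all add: swap_mat2 dim_mat2)
  qed
next
  fix M assume M: "M \<in> {?A, ?B}"
  have "swapcols 0 1 ?A \<in> exchange_class ?A"
    by (rule exchange_class.col_exchange[OF exchange_class.base]) (simp_all add: dim_mat2)
  then show "M \<in> exchange_class mat_L"
    using M exchange_class.base[of ?A] by (auto simp: mat_L_def swap_mat2)
qed

definition avoids :: "'a mat \<Rightarrow> 'a mat set \<Rightarrow> bool" where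
  "avoids M F \<longleftrightarrow>
    (\<forall>i1 i2 j1 j2. i1 < i2 \<and> i2 < dim_row M \<and> j1 < j2 \<and> j2 < dim_col M \<longrightarrow>
      submatrix M {i1, i2} {j1, j2} \<notin> F)"

text \<open>The values for \<open>k = 0\<close> or \<open>n = 0\<close> are a convention; they are not
  the number of empty matrices (which would be 1 throughout).\<close>

definition phi :: "nat \<Rightarrow> nat \<Rightarrow> nat mat \<Rightarrow> nat mat \<Rightarrow> nat" where
  "phi k n P Q =
    (if k = 0 \<and> n = 0 then 1
     else if k = 0 \<or> n = 0 then 0
     else card {M \<in> carrier_mat k n. elements_mat M \<subseteq> {0, 1} \<and>
                  avoids M (exchange_class P \<union> exchange_class Q)})"

text \<open>A power series in \<open>x\<close> and \<open>y\<close> is a power series in \<open>x\<close> whose coefficients are power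
  series in \<open>y\<close>: the coefficient of \<open>x^k * y^n\<close> in \<open>f\<close> is \<open>fps_nth (fps_nth f k) n\<close>.\<close>

definition var_x :: "rat fps fps" where "var_x = fps_X"

definition var_y :: "rat fps fps" where "var_y = fps_const fps_X"

definition Phi :: "nat mat \<Rightarrow> nat mat \<Rightarrow> rat fps fps" where
  "Phi P Q = Abs_fps (\<lambda>k. Abs_fps (\<lambda>n. of_nat (phi k n P Q) / (fact k * fact n)))"

text \<open>\<open>bfps_exp f\<close> is the series \<open>e^f\<close>, i.e. the sum of \<open>f^m / m!\<close> over all \<open>m\<close>, for \<open>f\<close>
  with zero constant term (it is meaningless for other \<open>f\<close>). By \<open>bfps_power_nth_eq_0\<close> the terms
  with \<open>m > k + n\<close> do not contribute to the coefficient of \<open>x^k * y^n\<close>. The library's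
  \<open>fps_exp\<close> needs a coefficient field, and \<open>fps_compose\<close> would need \<open>f\<close> to be a
  multiple of \<open>x\<close>.\<close>

definition bfps_exp :: "rat fps fps \<Rightarrow> rat fps fps" where
  "bfps_exp f = Abs_fps (\<lambda>k. Abs_fps (\<lambda>n. \<Sum>m\<le>k + n. fps_nth (fps_nth (f ^ m) k) n / fact m))"

lemma bfps_power_nth_eq_0:
  fixes f :: "rat fps fps"
  assumes "fps_nth (fps_nth f 0) 0 = 0" and "k + n < m"
  shows "fps_nth (fps_nth (f ^ m) k) n = 0"
  using assms(2)
proof (induction m arbitrary: k n)
  case 0
  then show ?case by simp
next
  case (Suc m)
  have "fps_nth (fps_nth f i) j * fps_nth (fps_nth (f ^ m) (k - i)) (n - j) = 0"
    if "i \<le> k" "j \<le> n" for i j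
  proof (cases "i = 0 \<and> j = 0")
    case True
    then show ?thesis using assms(1) by simp
  next
    case False
    then have "(k - i) + (n - j) < m" using Suc.prems that by auto
    then show ?thesis using Suc.IH by simp
  qed
  then show ?case
    by (force simp: fps_mult_nth fps_sum_nth intro!: sum.neutral)
qed

end

theory Submission
  imports Defs
begin

text \<open>
  Let \<open>k, n \<ge> 2\<close>. A matrix avoids both patterns exactly when its ones form a partial matching, that is,
  no row or column contains two of them, or its zeros do. Avoidance is clear for such matrices, and
  for the converse it suffices that a line with two ones and a line with two zeros cannot coexist. If,
  say, both are rows, then avoiding \<open>T\<close> yields a column with ones and a column with zeros in the same two
  rows, which is an \<open>L\<close> (\<open>avoiding_imp_matching\<close>).
  The number \<open>r(k, n)\<close> of partial matchings satisfies \<open>r(k + 1, n) = r(k, n) + n r(k, n - 1)\<close>, since a new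
  row is either empty or occupies one of the \<open>n\<close> columns (\<open>card_matchings\<close>).
  Complementation doubles this number, and only the two permutation matrices of size two belong to both
  families; hence \<open>\<phi>(k, n) = 2 r(k, n)\<close>, less two if \<open>k = n = 2\<close> (\<open>phi_eq_rook_number\<close>).
  With a single row or column nothing can be forbidden and \<open>\<phi>\<close> is a power of two.

  On the side of the power series, \<open>F = e^(xy + x + y)\<close> satisfies \<open>\<partial>F/\<partial>x = (1 + y) F\<close> and equals \<open>e^y\<close> at
  \<open>x = 0\<close>. For its coefficients this is the recurrence of \<open>r(k, n) / (k! n!)\<close>
  (\<open>bfps_exp_mixed_nth\<close>), so \<open>2 F\<close> gives the main term. The remaining terms of the formula correct
  the small cases: the square of \<open>xy\<close> accounts for \<open>k = n = 2\<close>, the terms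
  \<open>3 - 2 e^x - 2 e^y\<close> implement the convention for \<open>k = 0\<close> or \<open>n = 0\<close>, and the two last products
  together with \<open>2 xy\<close> turn \<open>2 r\<close> into a power of two for \<open>k = 1\<close> or \<open>n = 1\<close>.
\<close>

section \<open>Cell sets without the forbidden patterns\<close>

text \<open>A (0,1)-matrix is handled as the set of cells carrying a one. Only one orientation of each
  pattern has to be excluded, because the quantifiers cover both orders of the two lines.
  The first clause excludes the patterns in the class of \<open>T\<close>, the second those in the class of \<open>L\<close>;
  the degenerate choices \<open>i = i'\<close> in the first and \<open>j = j'\<close> in the second hold trivially.\<close>

definition avoiding :: "'a set \<Rightarrow> 'b set \<Rightarrow> ('a \<times> 'b) set \<Rightarrow> bool" where
  "avoiding A B S \<longleftrightarrow>
    (\<forall>i\<in>A. \<forall>i'\<in>A. \<forall>j\<in>B. \<forall>j'\<in>B. j \<noteq> j' \<longrightarrow>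
       (i, j) \<in> S \<longrightarrow> (i, j') \<in> S \<longrightarrow> (i', j) \<in> S \<or> (i', j') \<in> S) \<and>
    (\<forall>i\<in>A. \<forall>i'\<in>A. \<forall>j\<in>B. \<forall>j'\<in>B. i \<noteq> i' \<longrightarrow>
       (i, j) \<in> S \<longrightarrow> (i', j) \<in> S \<longrightarrow> (i, j') \<in> S \<or> (i', j') \<in> S)"

lemma avoiding_rowD:
  "\<lbrakk>avoiding A B S; i \<in> A; i' \<in> A; j \<in> B; j' \<in> B; j \<noteq> j'; (i, j) \<in> S; (i, j') \<in> S\<rbrakk>
    \<Longrightarrow> (i', j) \<in> S \<or> (i', j') \<in> S"
  unfolding avoiding_def by blast

lemma avoiding_colD:
  "\<lbrakk>avoiding A B S; i \<in> A; i' \<in> A; j \<in> B; j' \<in> B; i \<noteq> i'; (i, j) \<in> S; (i', j) \<in> S\<rbrakk>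
    \<Longrightarrow> (i, j') \<in> S \<or> (i', j') \<in> S"
  unfolding avoiding_def by blast

text \<open>Partial matchings of the complete bipartite graph on \<open>A\<close> and \<open>B\<close>, or placements of
  non-attacking rooks.\<close>

definition matchings :: "'a set \<Rightarrow> 'b set \<Rightarrow> ('a \<times> 'b) set set" where
  "matchings A B = {S. S \<subseteq> A \<times> B \<and> single_valued S \<and> single_valued (S\<inverse>)}"

lemma avoiding_complement: "avoiding A B (A \<times> B - S) \<longleftrightarrow> avoiding A B S"
  unfolding avoiding_def by blast

lemma avoiding_converse: "avoiding B A (S\<inverse>) \<longleftrightarrow> avoiding A B S"
  unfolding avoiding_def by blast

text \<open>Avoiding \<open>T\<close>, the two ones of row \<open>i\<close> force a column with ones in both rows, and two zeros of
  either row force a column with zeros in both rows. These two columns form an \<open>L\<close>.\<close>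

lemma avoiding_two_rows:
  assumes av: "avoiding A B S" and i: "i \<in> A" "i' \<in> A" and ne: "i \<noteq> i'"
    and j: "j \<in> B" "j' \<in> B" "j \<noteq> j'" "(i, j) \<in> S" "(i, j') \<in> S"
    and p: "p \<in> B" "p' \<in> B" "p \<noteq> p'" "(r, p) \<notin> S" "(r, p') \<notin> S"
    and r: "r = i \<or> r = i'"
  shows False
proof -
  have "(i', j) \<in> S \<or> (i', j') \<in> S"
    using avoiding_rowD[OF av i j] .
  then obtain q where q: "q \<in> B" "(i, q) \<in> S" "(i', q) \<in> S"
    using j by blast
  have "\<not> ((i, p) \<in> S \<and> (i, p') \<in> S)" "\<not> ((i', p) \<in> S \<and> (i', p') \<in> S)"
    using avoiding_rowD[OF av i p(1-3)] avoiding_rowD[OF av i(2,1) p(1-3)] p r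
      avoiding_rowD[OF av i(1,1) p(1-3)] avoiding_rowD[OF av i(2,2) p(1-3)] by blast+
  then obtain q' where q': "q' \<in> B" "(i, q') \<notin> S" "(i', q') \<notin> S"
    using p r by blast
  show False
    using avoiding_colD[OF av i q(1) q'(1) ne q(2,3)] q' by blast
qed

text \<open>The entry where the row meets the column must be a one, since otherwise, in rows \<open>i\<close> and \<open>p\<close> (or
  \<open>p'\<close>), column \<open>c\<close> forms an \<open>L\<close> with column \<open>j\<close> or \<open>j'\<close>. Then a second one of row \<open>i\<close>, in
  column \<open>q\<close>, forces ones at \<open>(p, q)\<close> and \<open>(p', q)\<close>, and columns \<open>q\<close> and \<open>c\<close> form an \<open>L\<close> in rows \<open>p\<close> and \<open>p'\<close>.\<close>

lemma avoiding_row_col: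
  assumes av: "avoiding A B S" and i: "i \<in> A"
    and j: "j \<in> B" "j' \<in> B" "j \<noteq> j'" "(i, j) \<in> S" "(i, j') \<in> S"
    and p: "c \<in> B" "p \<in> A" "p' \<in> A" "p \<noteq> p'" "(p, c) \<notin> S" "(p', c) \<notin> S"
  shows False
proof -
  have ic: "(i, c) \<in> S" if "r \<in> A" "(r, c) \<notin> S" "r \<noteq> i" for r
  proof (rule ccontr)
    assume c: "(i, c) \<notin> S"
    have "(r, j) \<in> S \<or> (r, j') \<in> S" using avoiding_rowD[OF av i that(1) j] .
    then show False
      using avoiding_colD[OF av i that(1) j(1) p(1)] avoiding_colD[OF av i that(1) j(2) p(1)]
        that j c by blast
  qed
  then have c: "(i, c) \<in> S" "p \<noteq> i" "p' \<noteq> i" using p by metis+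
  then have ne: "c \<noteq> j \<or> c \<noteq> j'" using j by blast
  have full: "(r, q) \<in> S" if "r \<in> A" "(r, c) \<notin> S" "q \<in> B" "q \<noteq> c" "(i, q) \<in> S" for r q
    using avoiding_rowD[OF av i that(1,3) p(1) that(4,5) c(1)] that by blast
  obtain q where q: "q \<in> B" "q \<noteq> c" "(i, q) \<in> S" using ne j by blast
  show False
    using avoiding_colD[OF av p(2,3) q(1) p(1) p(4)] full[OF p(2) p(5) q] full[OF p(3) p(6) q] p
    by blast
qed

lemma complement_matching:
  assumes av: "avoiding A B S" and i: "i \<in> A" and other: "i' \<in> A" "i' \<noteq> i"
    and j: "j \<in> B" "j' \<in> B" "j \<noteq> j'" "(i, j) \<in> S" "(i, j') \<in> S"
  shows "A \<times> B - S \<in> matchings A B"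
proof -
  have "single_valued (A \<times> B - S)"
  proof (rule single_valuedI, rule ccontr)
    fix r p p' assume rp: "(r, p) \<in> A \<times> B - S" "(r, p') \<in> A \<times> B - S" "p \<noteq> p'"
    show False
    proof (cases "r = i")
      case True
      then show False using avoiding_two_rows[OF av i other(1) _ j, of p p' r] other rp by blast
    next
      case False
      then show False using avoiding_two_rows[OF av i _ _ j, of r p p' r] rp by blast
    qed
  qed
  moreover have "single_valued ((A \<times> B - S)\<inverse>)"
    using avoiding_row_col[OF av i j] unfolding single_valued_def by blast
  ultimately show ?thesis by (auto simp: matchings_def)
qed

lemma converse_in_matchings: "S\<inverse> \<in> matchings B A \<longleftrightarrow> S \<in> matchings A B"
  unfolding matchings_def by auto

text \<open>The structural heart of the count. If the ones do not form a matching, some line contains two of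
  them, and by \<open>complement_matching\<close> no line contains two zeros. The last two hypotheses exclude a
  single row or column, which admits every filling.\<close>

lemma avoiding_imp_matching:
  assumes av: "avoiding A B S" and S: "S \<subseteq> A \<times> B"
    and A: "\<And>i. i \<in> A \<Longrightarrow> \<exists>i'\<in>A. i' \<noteq> i" and B: "\<And>j. j \<in> B \<Longrightarrow> \<exists>j'\<in>B. j' \<noteq> j"
  shows "S \<in> matchings A B \<or> A \<times> B - S \<in> matchings A B"
proof (cases "single_valued S")
  case False
  then obtain i j j' where ij: "(i, j) \<in> S" "(i, j') \<in> S" "j \<noteq> j'"
    unfolding single_valued_def by blast
  then have mem: "i \<in> A" "j \<in> B" "j' \<in> B" using S by auto
  obtain i' where "i' \<in> A" "i' \<noteq> i" using A mem by blast
  from complement_matching[OF av mem(1) this mem(2,3) ij(3,1,2)] show ?thesis ..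
next
  case sv: True
  show ?thesis
  proof (cases "single_valued (S\<inverse>)")
    case False
    then obtain i i' j where ij: "(j, i) \<in> S\<inverse>" "(j, i') \<in> S\<inverse>" "i \<noteq> i'"
      unfolding single_valued_def by blast
    then have mem: "j \<in> B" "i \<in> A" "i' \<in> A" using S by auto
    obtain j' where j': "j' \<in> B" "j' \<noteq> j" using B mem by blast
    have "avoiding B A (S\<inverse>)" using av by (simp add: avoiding_converse)
    from complement_matching[OF this mem(1) j' mem(2,3) ij(3,1,2)]
    have "B \<times> A - S\<inverse> \<in> matchings B A" .
    also have "B \<times> A - S\<inverse> = (A \<times> B - S)\<inverse>" by blast
    finally show ?thesis by (simp only: converse_in_matchings simp_thms)
  qed (use S sv in \<open>simp add: matchings_def\<close>)
qed

lemma matchings_avoiding: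
  assumes "S \<in> matchings A B"
  shows "avoiding A B S"
  using assms unfolding avoiding_def matchings_def single_valued_def by blast

section \<open>Counting matchings\<close>

lemma matchings_empty: "matchings {} B = {{}}"
  by (auto simp: matchings_def)

text \<open>Row \<open>a\<close> is either unmatched or matched to some column \<open>b\<close>, which is then lost to the other
  rows.\<close>

lemma matchings_insert:
  assumes "a \<notin> A"
  shows "matchings (insert a A) B =
    matchings A B \<union> (\<Union>b\<in>B. insert (a, b) ` matchings A (B - {b}))" (is "?L = ?R")
proof (intro equalityI subsetI)
  fix S assume S: "S \<in> ?L"
  show "S \<in> ?R"
  proof (cases "\<exists>b. (a, b) \<in> S")
    case True
    then obtain b where b: "(a, b) \<in> S" by blast
    have 1: "b \<in> B" using S b by (auto simp: matchings_def)
    have "S - {(a, b)} \<subseteq> A \<times> (B - {b})"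
      using S b unfolding matchings_def single_valued_def by blast
    then have 2: "S - {(a, b)} \<in> matchings A (B - {b})"
      using S unfolding matchings_def single_valued_def by blast
    have "S = insert (a, b) (S - {(a, b)})" using b by blast
    then show ?thesis using 1 2 by blast
  next
    case False
    then have "S \<subseteq> A \<times> B" using S by (auto simp: matchings_def)
    then show ?thesis using S by (simp add: matchings_def)
  qed
next
  fix S assume "S \<in> ?R"
  then consider "S \<in> matchings A B" | b R where "b \<in> B" "R \<in> matchings A (B - {b})" "S = insert (a, b) R"
    by blast
  then show "S \<in> ?L"
  proof cases
    case 1
    then show ?thesis by (auto simp: matchings_def)
  next
    case 2
    then have R: "R \<subseteq> A \<times> (B - {b})" "single_valued R" "single_valued (R\<inverse>)"
      by (simp_all add: matchings_def)
    have "S \<subseteq> insert a A \<times> B" using R(1) 2 by auto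
    moreover have "single_valued S"
      using R(1,2) assms unfolding 2 single_valued_def by blast
    moreover have "single_valued (S\<inverse>)"
      using R(1,3) assms unfolding 2 single_valued_def by blast
    ultimately show ?thesis by (simp add: matchings_def)
  qed
qed

lemma finite_matchings: "finite A \<Longrightarrow> finite B \<Longrightarrow> finite (matchings A B)"
  unfolding matchings_def by (rule finite_subset[of _ "Pow (A \<times> B)"]) auto

text \<open>The total number of non-attacking rook placements on a \<open>k\<close> by \<open>n\<close> board, in the recursive form
  that matches the differential equation of the exponential series. For \<open>n = 0\<close> the truncated \<open>n - 1\<close>
  is harmless because of the factor \<open>n\<close>.\<close>

fun rook_number :: "nat \<Rightarrow> nat \<Rightarrow> nat" where
  "rook_number 0 n = 1"
| "rook_number (Suc k) n = rook_number k n + n * rook_number k (n - 1)"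

lemma card_matchings:
  assumes "finite A" "finite B"
  shows "card (matchings A B) = rook_number (card A) (card B)"
  using assms
proof (induction A arbitrary: B rule: finite_induct)
  case empty
  then show ?case by (simp add: matchings_empty)
next
  case (insert a A)
  let ?U = "\<Union>b\<in>B. insert (a, b) ` matchings A (B - {b})"
  have notin: "(a, b) \<notin> S" if "S \<in> matchings A C" for b :: 'b and C S
    using that insert.hyps(2) by (auto simp: matchings_def)
  have inj: "inj_on (insert (a, b)) (matchings A C)" for b :: 'b and C
    by (rule inj_onI) (use notin in \<open>simp add: insert_ident\<close>)
  have "card ?U = (\<Sum>b\<in>B. card (insert (a, b) ` matchings A (B - {b})))"
  proof (rule card_UN_disjoint)
    show "\<forall>b\<in>B. \<forall>c\<in>B. b \<noteq> c \<longrightarrow>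
        insert (a, b) ` matchings A (B - {b}) \<inter> insert (a, c) ` matchings A (B - {c}) = {}"
      using notin by blast
  qed (use insert in \<open>simp_all add: finite_matchings\<close>)
  also have "\<dots> = (\<Sum>b\<in>B. rook_number (card A) (card B - 1))"
    using insert by (intro sum.cong) (simp_all add: card_image[OF inj])
  finally have U: "card ?U = card B * rook_number (card A) (card B - 1)" by simp
  have "card (matchings A B \<union> ?U) = card (matchings A B) + card ?U"
  proof (rule card_Un_disjoint)
    show "matchings A B \<inter> ?U = {}"
      using notin by blast
  qed (use insert in \<open>simp_all add: finite_matchings\<close>)
  then show ?case
    using insert U by (simp add: matchings_insert)
qed

section \<open>From matrices to cell sets\<close>

definition indicator_mat :: "nat \<Rightarrow> nat \<Rightarrow> (nat \<times> nat) set \<Rightarrow> nat mat" where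
  "indicator_mat k n S = mat k n (\<lambda>p. if p \<in> S then 1 else 0)"

lemma bij_betw_indicator_mat:
  "bij_betw (indicator_mat k n) (Pow ({..<k} \<times> {..<n}))
     {M \<in> carrier_mat k n. elements_mat M \<subseteq> {0, 1}}"
proof (rule bij_betw_byWitness[where f' = "\<lambda>M. {(i, j). i < k \<and> j < n \<and> M $$ (i, j) = 1}"])
  show "\<forall>M\<in>{M \<in> carrier_mat k n. elements_mat M \<subseteq> {0, 1 :: nat}}.
      indicator_mat k n {(i, j). i < k \<and> j < n \<and> M $$ (i, j) = 1} = M"
  proof
    fix M :: "nat mat" assume M: "M \<in> {M \<in> carrier_mat k n. elements_mat M \<subseteq> {0, 1}}"
    have "M $$ (i, j) \<in> {0, 1}" if "i < k" "j < n" for i j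
      using M that elements_matI[of M k n i j] by blast
    then show "indicator_mat k n {(i, j). i < k \<and> j < n \<and> M $$ (i, j) = 1} = M"
      using M by (intro eq_matI) (fastforce simp: indicator_mat_def)+
  qed
qed (auto simp: indicator_mat_def dest!: elements_matD split: if_splits)

lemma mat2_eq_iff:
  "mat_of_rows_list 2 [[a, b], [c, d]] = mat_of_rows_list 2 [[a', b'], [c', d']] \<longleftrightarrow>
    a = a' \<and> b = b' \<and> c = c' \<and> d = d'"
  by (auto simp: mat_of_rows_list_def mat_eq_iff less_2_cases_iff less_Suc_eq)

lemma submatrix_two_by_two:
  assumes "i1 < i2" "i2 < dim_row M" "j1 < j2" "j2 < dim_col M"
  shows "submatrix M {i1, i2} {j1, j2} =
    mat_of_rows_list 2 [[M $$ (i1, j1), M $$ (i1, j2)], [M $$ (i2, j1), M $$ (i2, j2)]]"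
proof -
  have pick: "pick {a, b} 0 = a" "pick {a, b} (Suc 0) = b" if "a < b" for a b :: nat
  proof -
    show 0: "pick {a, b} 0 = a"
      unfolding pick.simps using that by (intro Least_equality) auto
    show "pick {a, b} (Suc 0) = b"
      unfolding pick.simps(2) 0 using that by (intro Least_equality) auto
  qed
  have eq: "{i. i < d \<and> i \<in> {a, b}} = {a, b}" if "a < b" "b < d" for a b d :: nat
    using that by auto
  have card: "card {i. i < d \<and> i \<in> {a, b}} = 2" if "a < b" "b < d" for a b d :: nat
    unfolding eq[OF that] using that by simp
  show ?thesis
    unfolding submatrix_def card[OF assms(1,2)] card[OF assms(3,4)]
    by (intro eq_matI)
      (use assms in \<open>auto simp: mat_of_rows_list_def pick less_Suc_eq numeral_2_eq_2 simp del: pick.simps\<close>)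
qed

lemma avoids_indicator_mat:
  "avoids (indicator_mat k n S) (exchange_class mat_T \<union> exchange_class mat_L) \<longleftrightarrow>
    avoiding {..<k} {..<n} S" (is "?L \<longleftrightarrow> ?R")
proof -
  define bad where "bad i i' j j' \<longleftrightarrow>
    ((i, j) \<in> S \<longleftrightarrow> (i, j') \<in> S) \<and> ((i', j) \<in> S \<longleftrightarrow> (i', j') \<in> S) \<and> ((i, j) \<in> S \<longleftrightarrow> (i', j) \<notin> S) \<or>
    ((i, j) \<in> S \<longleftrightarrow> (i', j) \<in> S) \<and> ((i, j') \<in> S \<longleftrightarrow> (i', j') \<in> S) \<and> ((i, j) \<in> S \<longleftrightarrow> (i, j') \<notin> S)"
    for i i' j j'
  have bad_sym: "bad i' i j j' \<longleftrightarrow> bad i i' j j'" "bad i i' j' j \<longleftrightarrow> bad i i' j j'" for i i' j j'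
    unfolding bad_def by blast+
  have sub: "submatrix (indicator_mat k n S) {i, i'} {j, j'} \<in>
      exchange_class mat_T \<union> exchange_class mat_L \<longleftrightarrow> bad i i' j j'"
    if "i < i'" "i' < k" "j < j'" "j' < n" for i i' j j'
    using that unfolding exchange_class_T exchange_class_L bad_def
    by (subst submatrix_two_by_two) (auto simp: indicator_mat_def mat2_eq_iff)
  show ?thesis
  proof
    assume av: ?L
    have ordered: "\<not> bad i i' j j'" if "i < i'" "i' < k" "j < j'" "j' < n" for i i' j j'
      using av that sub[OF that] unfolding avoids_def by (auto simp: indicator_mat_def)
    have no_bad: "\<not> bad i i' j j'"
      if "i \<noteq> i'" "i < k" "i' < k" "j \<noteq> j'" "j < n" "j' < n" for i i' j j'
      using ordered[of i i' j j'] ordered[of i' i j j'] ordered[of i i' j' j] ordered[of i' i j' j]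
        that bad_sym by (metis linorder_neqE_nat)
    show ?R
      unfolding avoiding_def
    proof (intro conjI ballI impI)
      fix i i' j j'
      assume *: "i \<in> {..<k}" "i' \<in> {..<k}" "j \<in> {..<n}" "j' \<in> {..<n}"
      show "(i', j) \<in> S \<or> (i', j') \<in> S" if "j \<noteq> j'" "(i, j) \<in> S" "(i, j') \<in> S"
        using no_bad[of i i' j j'] * that unfolding bad_def by (cases "i = i'") auto
      show "(i, j') \<in> S \<or> (i', j') \<in> S" if "i \<noteq> i'" "(i, j) \<in> S" "(i', j) \<in> S"
        using no_bad[of i i' j j'] * that unfolding bad_def by (cases "j = j'") auto
    qed
  next
    assume av: ?R
    show ?L
      unfolding avoids_def
    proof (intro allI impI)
      fix i i' j j'
      assume "i < i' \<and> i' < dim_row (indicator_mat k n S) \<and>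
        j < j' \<and> j' < dim_col (indicator_mat k n S)"
      then have ij: "i < i'" "i' < k" "j < j'" "j' < n" by (simp_all add: indicator_mat_def)
      then have "i < k" "j < n" by simp_all
      then show "submatrix (indicator_mat k n S) {i, i'} {j, j'} \<notin>
          exchange_class mat_T \<union> exchange_class mat_L"
        unfolding sub[OF ij] bad_def using ij
          avoiding_rowD[OF av, of i i' j j'] avoiding_rowD[OF av, of i' i j j']
          avoiding_colD[OF av, of i i' j j'] avoiding_colD[OF av, of i i' j' j]
        by auto
    qed
  qed
qed

lemma phi_eq_card_avoiding:
  assumes "k > 0" "n > 0"
  shows "phi k n mat_T mat_L = card {S \<in> Pow ({..<k} \<times> {..<n}). avoiding {..<k} {..<n} S}"
proof -
  let ?P = "\<lambda>M. avoids M (exchange_class mat_T \<union> exchange_class mat_L)"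
  have "bij_betw (indicator_mat k n) {S \<in> Pow ({..<k} \<times> {..<n}). avoiding {..<k} {..<n} S}
      {M \<in> {M \<in> carrier_mat k n. elements_mat M \<subseteq> {0, 1}}. ?P M}"
    by (rule bij_betw_Collect[OF bij_betw_indicator_mat]) (simp add: avoids_indicator_mat)
  from bij_betw_same_card[OF this] show ?thesis
    using assms by (simp add: phi_def conj_assoc)
qed

section \<open>The values of \<open>\<phi>\<close>\<close>

lemma phi_single:
  assumes "k > 0" "n > 0" "k = 1 \<or> n = 1"
  shows "phi k n mat_T mat_L = 2 ^ (k * n)"
proof -
  have "avoiding {..<k} {..<n} S" for S
    using assms(3) by (auto simp: avoiding_def)
  then show ?thesis
    using assms card_Pow[of "{..<k} \<times> {..<n}"] by (simp add: phi_eq_card_avoiding Pow_def)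
qed

text \<open>The overlap of the two families has to be subtracted. If a matching has a matching as its complement,
  then among any two cells of a line exactly one is occupied, so no line has three cells.\<close>

lemma matching_and_complement_row:
  assumes "S \<in> matchings A B" "A \<times> B - S \<in> matchings A B"
    and "a \<in> A" "b \<in> B" "c \<in> B" "b \<noteq> c"
  shows "(a, b) \<in> S \<longleftrightarrow> (a, c) \<notin> S"
proof -
  have "single_valued S" "single_valued (A \<times> B - S)"
    using assms(1,2) by (simp_all add: matchings_def)
  then show ?thesis
    using single_valuedD[of S a b c] single_valuedD[of "A \<times> B - S" a b c] assms(3-) by auto
qed

lemma matching_and_complement:
  assumes S: "S \<in> matchings A B" "A \<times> B - S \<in> matchings A B" and "finite A" "A \<noteq> {}" "finite B"
  shows "card B \<le> 2"
proof (rule ccontr)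
  assume "\<not> card B \<le> 2"
  then have "3 \<le> card B" by simp
  then obtain C where C: "C \<subseteq> B" "card C = 3"
    by (metis obtain_subset_with_card_n)
  then obtain b1 b2 b3 where b: "b1 \<in> B" "b2 \<in> B" "b3 \<in> B" "b1 \<noteq> b2" "b1 \<noteq> b3" "b2 \<noteq> b3"
    by (auto simp: card_3_iff)
  obtain a where a: "a \<in> A" using assms by blast
  show False
    using matching_and_complement_row[OF S a] b by metis
qed

lemma matching_and_complement_two:
  "{S \<in> matchings {..<2} {..<2}. {..<2} \<times> {..<2} - S \<in> matchings {..<2} {..<2}} =
    {{(0 :: nat, 0 :: nat), (1, 1)}, {(0, 1), (1, 0)}}" (is "?L = ?R")
proof -
  have two: "{..<2} = {0, 1 :: nat}" by auto
  show ?thesis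
  proof (intro equalityI subsetI)
    fix S :: "(nat \<times> nat) set" assume S: "S \<in> ?L"
    then have SM: "S \<in> matchings {..<2} {..<2}" "{..<2} \<times> {..<2} - S \<in> matchings {..<2} {..<2}"
      by simp_all
    have "{..<2} \<times> {..<2} - S\<inverse> = ({..<2} \<times> {..<2} - S)\<inverse>" by blast
    then have SM': "S\<inverse> \<in> matchings {..<2} {..<2}" "{..<2} \<times> {..<2} - S\<inverse> \<in> matchings {..<2} {..<2}"
      using SM by (simp_all only: converse_in_matchings)
    have row: "(i, 0) \<in> S \<longleftrightarrow> (i, 1) \<notin> S" if "i < 2" for i
      using matching_and_complement_row[OF SM, of i 0 1] that by simp
    have col: "(0, j) \<in> S \<longleftrightarrow> (1, j) \<notin> S" if "j < 2" for j
      using matching_and_complement_row[OF SM', of j 0 1] that by simp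
    have "S \<subseteq> {0, 1} \<times> {0, 1}" using S by (auto simp: matchings_def two)
    then show "S \<in> ?R"
      using row[of 0] row[of 1] col[of 0] by (cases "(0, 0) \<in> S") auto
  next
    fix S assume "S \<in> ?R"
    then show "S \<in> ?L"
      unfolding matchings_def two by (auto simp: single_valued_def)
  qed
qed

text \<open>Inclusion-exclusion for the matchings and their complements. They overlap only in the two permutation
  matrices of size two, which are complements of each other.\<close>

lemma phi_eq_rook_number:
  assumes "k \<ge> 2" "n \<ge> 2"
  shows "phi k n mat_T mat_L = 2 * rook_number k n - (if k = 2 \<and> n = 2 then 2 else 0)"
proof -
  let ?U = "{..<k} \<times> {..<n}" and ?M = "matchings {..<k} {..<n}"
  have sub: "?M \<subseteq> Pow ?U" by (auto simp: matchings_def)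
  have other: "\<exists>i'\<in>{..<m}. i' \<noteq> i" if "m \<ge> 2" for i m :: nat
    using that by (cases "i = 0") (auto intro: bexI[of _ 1] bexI[of _ 0])
  have inv: "?U - (?U - S) = S" if "S \<in> ?M" for S
    using sub that by blast
  have "{S \<in> Pow ?U. avoiding {..<k} {..<n} S} = ?M \<union> (\<lambda>S. ?U - S) ` ?M"
  proof (intro equalityI subsetI)
    fix S assume S: "S \<in> {S \<in> Pow ?U. avoiding {..<k} {..<n} S}"
    then have "S \<in> ?M \<or> ?U - S \<in> ?M"
      using assms by (intro avoiding_imp_matching other) auto
    moreover have "S = ?U - (?U - S)" using S by blast
    ultimately show "S \<in> ?M \<union> (\<lambda>S. ?U - S) ` ?M" by blast
  next
    fix S assume "S \<in> ?M \<union> (\<lambda>S. ?U - S) ` ?M"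
    then show "S \<in> {S \<in> Pow ?U. avoiding {..<k} {..<n} S}"
      using sub by (auto simp: avoiding_complement matchings_avoiding)
  qed
  moreover have "card (?M \<union> (\<lambda>S. ?U - S) ` ?M) + card (?M \<inter> (\<lambda>S. ?U - S) ` ?M) =
      card ?M + card ((\<lambda>S. ?U - S) ` ?M)"
    by (rule card_Un_Int[symmetric]) (simp_all add: finite_matchings)
  moreover have "card ((\<lambda>S. ?U - S) ` ?M) = card ?M"
    by (rule card_image, rule inj_on_inverseI[where g = "\<lambda>S. ?U - S"]) (rule inv)
  moreover have "card ?M = rook_number k n"
    by (simp add: card_matchings)
  moreover have "?M \<inter> (\<lambda>S. ?U - S) ` ?M = {S \<in> ?M. ?U - S \<in> ?M}"
  proof (intro equalityI subsetI)
    fix S assume "S \<in> {S \<in> ?M. ?U - S \<in> ?M}"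
    then show "S \<in> ?M \<inter> (\<lambda>S. ?U - S) ` ?M"
      using inv[of S] by (metis (mono_tags, lifting) IntI image_eqI mem_Collect_eq)
  qed (auto simp: inv)
  moreover have "card {S \<in> ?M. ?U - S \<in> ?M} = (if k = 2 \<and> n = 2 then 2 else 0)"
  proof (cases "k = 2 \<and> n = 2")
    case True
    then show ?thesis by (simp add: matching_and_complement_two) (simp add: doubleton_eq_iff)
  next
    case False
    have "S \<notin> ?M \<or> ?U - S \<notin> ?M" for S
    proof (rule ccontr)
      assume "\<not> (S \<notin> ?M \<or> ?U - S \<notin> ?M)"
      then have S: "S \<in> ?M" "?U - S \<in> ?M" by simp_all
      have "n \<le> 2"
        using matching_and_complement[OF S] assms by (auto simp: lessThan_empty_iff)
      moreover have "k \<le> 2"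
      proof -
        have "{..<n} \<times> {..<k} - S\<inverse> = (?U - S)\<inverse>" by blast
        then show ?thesis
          using matching_and_complement[of "S\<inverse>" "{..<n}" "{..<k}"] S assms
          by (auto simp: lessThan_empty_iff converse_in_matchings)
      qed
      ultimately show False using False assms by simp
    qed
    then have none: "{S \<in> ?M. ?U - S \<in> ?M} = {}" by blast
    show ?thesis unfolding none using False by simp
  qed
  ultimately show ?thesis
    using assms by (simp add: phi_eq_card_avoiding)
qed

section \<open>Coefficients of the exponential series\<close>

no_notation vec_index (infixl "$" 100)
unbundle fps_syntax

lemma rook_number_0_right: "rook_number k 0 = 1"
  by (induction k) auto

lemma rook_number_1_right: "rook_number k (Suc 0) = Suc k"
  by (induction k) (auto simp: rook_number_0_right)

lemma bfps_exp_x_nth: "bfps_exp var_x $ k $ n = (if n = 0 then 1 / fact k else 0)"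
proof -
  have "(var_x ^ m) $ k $ n / fact m = (if m = k then if n = 0 then 1 / fact k else 0 else 0)" for m
    by (auto simp: var_x_def)
  then show ?thesis by (simp add: bfps_exp_def)
qed

lemma bfps_exp_y: "bfps_exp var_y = fps_const (fps_exp 1)"
proof (intro fps_ext)
  fix k n
  have "(var_y ^ m) $ k $ n / fact m = (if m = n then if k = 0 then 1 / fact n else 0 else 0)" for m
    by (auto simp: var_y_def)
  then show "bfps_exp var_y $ k $ n = fps_const (fps_exp 1) $ k $ n"
    by (simp add: bfps_exp_def)
qed

text \<open>The embedding of one-variable series that sends the variable to \<open>x\<close>. As the coefficients of a
  bivariate series are series in \<open>y\<close>, the analogous embedding for \<open>y\<close> is just \<^const>\<open>fps_const\<close>.\<close>

definition series_in_x :: "rat fps \<Rightarrow> rat fps fps" where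
  "series_in_x g = Abs_fps (\<lambda>k. fps_const (g $ k))"

lemma series_in_x_simps:
  "series_in_x (f * g) = series_in_x f * series_in_x g"
  "series_in_x (f - g) = series_in_x f - series_in_x g"
  "series_in_x 1 = 1" "series_in_x (numeral m) = numeral m" "series_in_x fps_X = var_x"
  "series_in_x (fps_exp 1) = bfps_exp var_x"
proof -
  have s: "fps_const (sum h I) = (\<Sum>i\<in>I. fps_const (h i))" for h :: "nat \<Rightarrow> rat" and I
    by (induction I rule: infinite_finite_induct) (auto simp flip: fps_const_add)
  show "series_in_x (f * g) = series_in_x f * series_in_x g"
    by (simp add: series_in_x_def fps_eq_iff[of "Abs_fps _"] fps_mult_nth s)
  show "series_in_x (f - g) = series_in_x f - series_in_x g"
    by (simp add: series_in_x_def fps_eq_iff[of "Abs_fps _"])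
  show "series_in_x 1 = 1"
    by (simp add: series_in_x_def fps_eq_iff[of "Abs_fps _"])
  show "series_in_x (numeral m) = numeral m"
    by (simp add: series_in_x_def fps_eq_iff[of "Abs_fps _"] fps_numeral_nth numeral_fps_const)
  show "series_in_x fps_X = var_x"
    by (simp add: series_in_x_def fps_eq_iff[of "Abs_fps _"] var_x_def)
  show "series_in_x (fps_exp 1) = bfps_exp var_x"
    by (intro fps_ext) (simp add: series_in_x_def bfps_exp_x_nth)
qed

text \<open>The factor of \<open>x\<close> (with \<open>e^y\<close>) and of \<open>y\<close> (with \<open>e^x\<close>) in the formula. It corrects the counts for
  matrices with a single row or column, where every filling is allowed: for
  \<open>n \<ge> 2\<close>, its \<open>n\<close>-th coefficient times \<open>n!\<close> is \<open>2^n\<close> minus twice the rook number \<open>n + 1\<close>.\<close>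

definition single_line_series :: "rat fps" where
  "single_line_series = (fps_exp 1 - 2 * fps_X - 1) * (fps_exp 1 - 1)"

lemma single_line_series_nth:
  "single_line_series $ n = (if n \<le> 1 then 0 else (2 ^ n - 2 - 2 * of_nat n) / fact n)"
proof -
  have "single_line_series =
      fps_exp 2 - fps_const 2 * fps_exp 1 + 1 - fps_X * (fps_const 2 * fps_exp 1 - fps_const 2)"
    using fps_exp_add_mult[of "1::rat" 1]
    by (simp add: single_line_series_def algebra_simps numeral_fps_const)
  then have "single_line_series $ n = (fps_exp 2 - fps_const 2 * fps_exp 1 + 1
      - fps_X * (fps_const 2 * fps_exp 1 - fps_const 2)) $ n"
    by (rule arg_cong)
  also have "\<dots> = 2 ^ n / fact n - 2 / fact n + (if n = 0 then 1 else 0)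
      - (if n = 0 then 0 else 2 / fact (n - 1) - (if n = 1 then 2 else 0))"
    by simp
  finally have nth: "single_line_series $ n = 2 ^ n / fact n - 2 / fact n + (if n = 0 then 1 else 0)
      - (if n = 0 then 0 else 2 / fact (n - 1) - (if n = 1 then 2 else 0))" .
  consider "n = 0" | "n = 1" | "n \<ge> 2" by linarith
  then show ?thesis
  proof cases
    case 1
    show ?thesis unfolding nth using 1 by simp
  next
    case 2
    show ?thesis unfolding nth using 2 by simp
  next
    case 3
    then have "fact n = (of_nat n * fact (n - 1) :: rat)" by (simp add: fact_reduce)
    then show ?thesis unfolding nth using 3 by (simp add: field_simps)
  qed
qed

text \<open>Coefficients at different positions are truncated differently in \<^const>\<open>bfps_exp\<close>; comparing them
  needs a common bound on the summation.\<close>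

lemma bfps_exp_nth_ge:
  assumes "f $ 0 $ 0 = 0" "k + n \<le> N"
  shows "bfps_exp f $ k $ n = (\<Sum>m\<le>N. (f ^ m) $ k $ n / fact m)"
proof -
  have "(\<Sum>m\<le>k + n. (f ^ m) $ k $ n / fact m) = (\<Sum>m\<le>N. (f ^ m) $ k $ n / fact m)"
    using assms by (intro sum.mono_neutral_left) (auto simp: bfps_power_nth_eq_0)
  then show ?thesis by (simp add: bfps_exp_def)
qed

text \<open>This is the differential equation \<open>\<partial>F/\<partial>x = (1 + y) F\<close> of \<open>F = e^(xy + x + y)\<close>, obtained termwise
  from the derivatives of the powers of the exponent.\<close>

lemma bfps_exp_mixed_recurrence:
  fixes f :: "rat fps fps"
  defines "f \<equiv> var_x * var_y + var_x + var_y"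
  shows "of_nat (Suc k) * bfps_exp f $ Suc k $ n =
      bfps_exp f $ k $ n + (if n = 0 then 0 else bfps_exp f $ k $ (n - 1))"
proof -
  have f0: "f $ 0 $ 0 = 0" by (simp add: f_def var_x_def var_y_def)
  have f': "fps_deriv f = fps_const (1 + fps_X)"
    by (simp add: f_def var_x_def var_y_def flip: fps_const_add)
  have step: "of_nat (Suc k) * ((f ^ Suc m) $ Suc k $ n / fact (Suc m)) =
      (f ^ m) $ k $ n / fact m + (if n = 0 then 0 else (f ^ m) $ k $ (n - 1) / fact m)" for m
  proof -
    have "of_nat (Suc k) * (f ^ Suc m) $ Suc k = fps_deriv (f ^ Suc m) $ k"
      by (simp only: fps_deriv_nth Suc_eq_plus1)
    also have "fps_deriv (f ^ Suc m) = of_nat (Suc m) * (fps_const (1 + fps_X) * f ^ m)"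
      by (simp only: fps_deriv_power' f' diff_Suc_1 mult.assoc)
    also have "\<dots> $ k = of_nat (Suc m) * ((1 + fps_X) * (f ^ m) $ k)"
      by (simp only: fps_mult_of_nat_nth fps_mult_left_const_nth)
    finally have "(of_nat (Suc k) * (f ^ Suc m) $ Suc k) $ n =
        (of_nat (Suc m) * ((1 + fps_X) * (f ^ m) $ k)) $ n" by (rule arg_cong)
    then have *: "of_nat (Suc k) * (f ^ Suc m) $ Suc k $ n =
        of_nat (Suc m) * ((f ^ m) $ k $ n + (if n = 0 then 0 else (f ^ m) $ k $ (n - 1)))"
      by (simp only: fps_mult_of_nat_nth distrib_right mult_1 fps_add_nth fps_X_mult_nth)
    have "of_nat (Suc k) * ((f ^ Suc m) $ Suc k $ n / fact (Suc m)) =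
        (of_nat (Suc k) * (f ^ Suc m) $ Suc k $ n) / (of_nat (Suc m) * fact m)"
      by (simp only: times_divide_eq_right fact_Suc)
    also have "\<dots> = ((f ^ m) $ k $ n + (if n = 0 then 0 else (f ^ m) $ k $ (n - 1))) / fact m"
      unfolding * by (simp only: mult_divide_mult_cancel_left of_nat_neq_0 simp_thms)
    finally show ?thesis by (simp add: add_divide_distrib)
  qed
  have "of_nat (Suc k) * bfps_exp f $ Suc k $ n =
      of_nat (Suc k) * (\<Sum>m\<le>Suc (k + n). (f ^ m) $ Suc k $ n / fact m)"
    by (subst bfps_exp_nth_ge[OF f0, of _ _ "Suc (k + n)"]) simp_all
  also have "\<dots> = of_nat (Suc k) * (\<Sum>m\<le>k + n. (f ^ Suc m) $ Suc k $ n / fact (Suc m))"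
    by (simp only: sum.atMost_Suc_shift) simp
  also have "\<dots> = (\<Sum>m\<le>k + n. of_nat (Suc k) * ((f ^ Suc m) $ Suc k $ n / fact (Suc m)))"
    by (rule sum_distrib_left)
  also have "\<dots> = (\<Sum>m\<le>k + n. (f ^ m) $ k $ n / fact m) +
      (if n = 0 then 0 else (\<Sum>m\<le>k + n. (f ^ m) $ k $ (n - 1) / fact m))"
    unfolding step by (simp add: sum.distrib)
  also have "\<dots> = bfps_exp f $ k $ n + (if n = 0 then 0 else bfps_exp f $ k $ (n - 1))"
    by (simp add: bfps_exp_nth_ge[OF f0, of _ _ "k + n"])
  finally show ?thesis .
qed

text \<open>After multiplication by \<open>k! n!\<close> the recurrence of the coefficients becomes that of
  the rook numbers.\<close>

lemma bfps_exp_mixed_nth: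
  "bfps_exp (var_x * var_y + var_x + var_y) $ k $ n = of_nat (rook_number k n) / (fact k * fact n)"
proof (induction k arbitrary: n)
  case 0
  have "((var_x * var_y + var_x + var_y) ^ m) $ 0 = fps_X ^ m" for m
    by (simp add: fps_power_zeroth var_x_def var_y_def)
  then have "((var_x * var_y + var_x + var_y) ^ m) $ 0 $ n / fact m =
      (if m = n then 1 / fact n else 0)" for m
    by simp
  then show ?case by (simp add: bfps_exp_def)
next
  case (Suc k)
  have "of_nat (Suc k) * bfps_exp (var_x * var_y + var_x + var_y) $ Suc k $ n =
      of_nat (rook_number k n) / (fact k * fact n) +
      (if n = 0 then 0 else of_nat (rook_number k (n - 1)) / (fact k * fact (n - 1)))"
    using bfps_exp_mixed_recurrence[of k n] unfolding Suc.IH .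
  also have "\<dots> = of_nat (rook_number (Suc k) n) / (fact k * fact n)"
    by (cases n) (simp_all add: field_simps del: of_nat_Suc, simp add: algebra_simps)
  finally show ?case
    by (simp add: divide_simps del: of_nat_Suc) (simp add: algebra_simps)
qed

lemma rook_number_2_2: "rook_number 2 2 = 7"
  by (simp add: numeral_2_eq_2)

theorem mainTheorem8:
  fixes x y :: "rat fps fps"
  defines "x \<equiv> var_x" and "y \<equiv> var_y"
  shows "Phi mat_T mat_L =
    2 * bfps_exp (x * y + x + y) - fps_const (fps_const (1 / 2)) * (x * y) ^ 2 - 2 * (x * y) + 3
    - 2 * bfps_exp x - 2 * bfps_exp y
    + x * (bfps_exp y - 2 * y - 1) * (bfps_exp y - 1)
    + y * (bfps_exp x - 2 * x - 1) * (bfps_exp x - 1)"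
proof (intro fps_ext)
  fix k n
  let ?h = "single_line_series"
  have "x * (bfps_exp y - 2 * y - 1) * (bfps_exp y - 1) = fps_X * fps_const ?h"
    unfolding x_def y_def bfps_exp_y
    by (simp add: var_x_def var_y_def single_line_series_def mult.assoc numeral_fps_const
        flip: fps_const_1_eq_1)
  then have row: "(x * (bfps_exp y - 2 * y - 1) * (bfps_exp y - 1)) $ k $ n =
      (if k = 1 then ?h $ n else 0)"
    by auto
  have "y * (bfps_exp x - 2 * x - 1) * (bfps_exp x - 1) = y * series_in_x ?h"
    by (simp add: x_def single_line_series_def series_in_x_simps mult.assoc)
  then have col: "(y * (bfps_exp x - 2 * x - 1) * (bfps_exp x - 1)) $ k $ n =
      (if n = 1 then ?h $ k else 0)"
    by (simp only:) (simp add: y_def var_y_def series_in_x_def)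
  have "(x * y) ^ 2 = fps_X ^ 2 * fps_const (fps_X ^ 2)"
    by (simp add: x_def y_def var_x_def var_y_def power_mult_distrib)
  then have sq: "(fps_const (fps_const (1 / 2)) * (x * y) ^ 2) $ k $ n =
      (if k = 2 \<and> n = 2 then 1 / 2 else 0)"
    by (simp add: fps_X_power_mult_nth)
  have xy: "(x * y) $ k $ n = (if k = 1 \<and> n = 1 then 1 else 0)"
    by (simp add: x_def y_def var_x_def var_y_def)
  have two: "(2 * F) $ k $ n = 2 * F $ k $ n" for F :: "rat fps fps"
    by (simp add: numeral_fps_const)
  have three: "(3 :: rat fps fps) $ k $ n = (if k = 0 \<and> n = 0 then 3 else 0)"
    by (simp add: fps_numeral_nth)
  have ey: "bfps_exp y $ k $ n = (if k = 0 then 1 / fact n else 0)"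
    by (simp add: y_def bfps_exp_y)
  have ex: "bfps_exp x $ k $ n = (if n = 0 then 1 / fact k else 0)"
    by (simp add: x_def bfps_exp_x_nth)
  have exy: "bfps_exp (x * y + x + y) $ k $ n = of_nat (rook_number k n) / (fact k * fact n)"
    by (simp only: x_def y_def bfps_exp_mixed_nth)
  have phi: "Phi mat_T mat_L $ k $ n = of_nat (phi k n mat_T mat_L) / (fact k * fact n)"
    by (simp add: Phi_def)
  have "of_nat (phi k n mat_T mat_L) / (fact k * fact n) =
      2 * (of_nat (rook_number k n) / (fact k * fact n)) - (if k = 2 \<and> n = 2 then 1 / 2 else 0)
      - 2 * (if k = 1 \<and> n = 1 then 1 else 0) + (if k = 0 \<and> n = 0 then 3 else 0)
      - 2 * (if n = 0 then 1 / fact k else 0) - 2 * (if k = 0 then 1 / fact n else 0)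
      + (if k = 1 then ?h $ n else 0) + (if n = 1 then ?h $ k else (0 :: rat))"
  proof -
    consider "k = 0 \<or> n = 0" | "k = 1" "n \<ge> 1" | "n = 1" "k \<ge> 2" | "k \<ge> 2" "n \<ge> 2"
      by linarith
    then show ?thesis
    proof cases
      case 1
      then show ?thesis
        by (cases "k = 0"; cases "n = 0") (auto simp: phi_def rook_number_0_right single_line_series_nth)
    next
      case 2
      then show ?thesis
        by (cases "n = 1") (auto simp: phi_single single_line_series_nth field_simps)
    next
      case 3
      then show ?thesis
        by (auto simp: phi_single rook_number_1_right single_line_series_nth field_simps)
    next
      case 4
      then show ?thesis
        by (cases "k = 2 \<and> n = 2") (auto simp: phi_eq_rook_number rook_number_2_2)
    qed
  qed
  then show "Phi mat_T mat_L $ k $ n =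
    (2 * bfps_exp (x * y + x + y) - fps_const (fps_const (1 / 2)) * (x * y) ^ 2 - 2 * (x * y) + 3
    - 2 * bfps_exp x - 2 * bfps_exp y
    + x * (bfps_exp y - 2 * y - 1) * (bfps_exp y - 1)
    + y * (bfps_exp x - 2 * x - 1) * (bfps_exp x - 1)) $ k $ n"
    by (simp only: fps_add_nth fps_sub_nth phi exy sq xy three two ex ey row col)
qed

end
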